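(* Consider the class of locally convex plane curves $\gamma(\alpha)$, parameterized by angle, such that $\gamma(\alpha+2\pi)=\gamma(\alpha)-(2\pi,0)$ and such that the periodic part $f$ of the support function $p(\alpha)=-\alpha\cos\alpha+f(\alpha)$ has zero average. On this class, the operation of taking the involute is defined and unique, and under its iteration every curve converges to the cycloid obtained from the one with the support function $-\alpha\cos\alpha$ by a parallel translation. If a curve of this class differs from its evolute by a parallel translation, then the curve is the cycloid.
   Context: The support function $p(\alpha)$ of a locally convex cooriented curve (cusps allowed), parameterized by the angle $\alpha$ of its coorienting normal $(\cos\alpha,\sin\alpha)$, is the signed distance from the origin to the tangent line at $\gamma(\alpha)$; then $\gamma(\alpha)=(p\cos\alpha-p'\sin\alpha,\ p\sin\alpha+p'\cos\alpha)$. If $\gamma(\alpha+2\pi)=\gamma(\alpha)-(2\pi,0)$, then $p(\alpha)=-\alpha\cos\alpha+f(\alpha)$ with $f$ a $2\pi$-periodic function, called here the periodic part of $p$. The evolute of a curve is the envelope of its normal lines; its support function is $\alpha\mapsto p'(\alpha-\pi/2)$. An involute of a curve is a curve (here, of the class under consideration) whose evolute is the given curve. The curve with support function $-\alpha\cos\alpha$ is a cycloid; parallel translation of a curve by $(a,b)$ adds $a\cos\alpha+b\sin\alpha$ to its support function.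
   Formalization: Curves are taken C^∞; since even the cycloid is shifted by −(π/2,−1) by each involute, convergence is stated (uniformly) for the n-th involute after translating it by n(π/2,−1), and "is the cycloid" means up to parallel translation. *)

theory Defs
  imports "HOL-Analysis.Analysis"
begin

type_synonym curve = "real \<Rightarrow> real \<times> real"

definition normal :: "real \<Rightarrow> real \<times> real" where
  "normal \<alpha> = (cos \<alpha>, sin \<alpha>)"

definition smooth :: "curve \<Rightarrow> bool" where
  "smooth \<gamma> \<longleftrightarrow>
     (\<forall>n t. ((\<lambda>g t. vector_derivative g (at t)) ^^ n) \<gamma> differentiable (at t))"

text \<open>
  A cooriented locally convex curve, parameterized by the angle of its coorienting normal.
  The velocity may vanish (a cusp); the tangent line is then still the line through
  the point orthogonal to the coorienting normal.
\<close>

definition angle_curve :: "curve \<Rightarrow> bool" where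
  "angle_curve \<gamma> \<longleftrightarrow>
     smooth \<gamma> \<and> (\<forall>\<alpha>. vector_derivative \<gamma> (at \<alpha>) \<bullet> normal \<alpha> = 0)"

definition tangent_line :: "curve \<Rightarrow> real \<Rightarrow> (real \<times> real) set" where
  "tangent_line \<gamma> \<alpha> = {x. (x - \<gamma> \<alpha>) \<bullet> normal \<alpha> = 0}"

definition normal_line :: "curve \<Rightarrow> real \<Rightarrow> (real \<times> real) set" where
  "normal_line \<gamma> \<alpha> = {\<gamma> \<alpha> + t *\<^sub>R normal \<alpha> | t. True}"

definition support :: "curve \<Rightarrow> real \<Rightarrow> real" where
  "support \<gamma> \<alpha> = \<gamma> \<alpha> \<bullet> normal \<alpha>"

definition curve_of_support :: "(real \<Rightarrow> real) \<Rightarrow> curve" where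
  "curve_of_support p \<alpha> =
     (p \<alpha> * cos \<alpha> - deriv p \<alpha> * sin \<alpha>, p \<alpha> * sin \<alpha> + deriv p \<alpha> * cos \<alpha>)"

definition translate :: "real \<times> real \<Rightarrow> curve \<Rightarrow> curve" where
  "translate v \<gamma> = (\<lambda>\<alpha>. \<gamma> \<alpha> + v)"

definition cycloid :: curve where
  "cycloid = curve_of_support (\<lambda>\<alpha>. - \<alpha> * cos \<alpha>)"

text \<open>
  \<open>is_evolute \<gamma> \<epsilon>\<close>: the curve \<open>\<epsilon>\<close> is the envelope of the normal lines of \<open>\<gamma>\<close>.
  The coorienting normal of \<open>\<epsilon>\<close> at the point of tangency with the normal line at angle \<open>\<alpha>\<close>
  is the one at angle \<open>\<alpha> + pi / 2\<close>; see \<open>is_evolute_iff_support\<close> below.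
\<close>

definition is_evolute :: "curve \<Rightarrow> curve \<Rightarrow> bool" where
  "is_evolute \<gamma> \<epsilon> \<longleftrightarrow>
     angle_curve \<epsilon> \<and> (\<forall>\<alpha>. tangent_line \<epsilon> (\<alpha> + pi / 2) = normal_line \<gamma> \<alpha>)"

definition periodic_part :: "curve \<Rightarrow> real \<Rightarrow> real" where
  "periodic_part \<gamma> \<alpha> = support \<gamma> \<alpha> + \<alpha> * cos \<alpha>"

definition cycloidal :: "curve set" where
  "cycloidal = {\<gamma>. angle_curve \<gamma> \<and> (\<forall>\<alpha>. \<gamma> (\<alpha> + 2 * pi) = \<gamma> \<alpha> - (2 * pi, 0)) \<and>
     integral {0..2 * pi} (periodic_part \<gamma>) / (2 * pi) = 0}"

definition is_involute :: "curve \<Rightarrow> curve \<Rightarrow> bool" where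
  "is_involute \<gamma> \<iota> \<longleftrightarrow> \<iota> \<in> cycloidal \<and> is_evolute \<iota> \<gamma>"

definition involute :: "curve \<Rightarrow> curve" where
  "involute \<gamma> = (THE \<iota>. is_involute \<gamma> \<iota>)"

text \<open>
  The evolute of the cycloid is not the cycloid itself but its translate by this vector
  (\<open>cycloid_evolute\<close> below).  Hence every involution step moves even the cycloid by the
  opposite vector, and iterated involutes converge only after this drift is undone.
\<close>

definition drift :: "real \<times> real" where
  "drift = (pi / 2, - 1)"

lemma angle_curve_support_deriv:
  assumes "angle_curve \<gamma>"
  shows "(support \<gamma> has_real_derivative \<gamma> \<alpha> \<bullet> normal (\<alpha> + pi / 2)) (at \<alpha>)"
proof -
  have "((\<lambda>g t. vector_derivative g (at t)) ^^ 0) \<gamma> differentiable (at \<alpha>)"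
    using assms unfolding angle_curve_def smooth_def by blast
  then have d: "(\<gamma> has_vector_derivative vector_derivative \<gamma> (at \<alpha>)) (at \<alpha>)"
    by (simp add: vector_derivative_works)
  have n: "(normal has_vector_derivative normal (\<alpha> + pi / 2)) (at \<alpha>)"
    unfolding normal_def
    by (rule has_vector_derivative_eq_rhs, rule has_vector_derivative_Pair)
       (auto intro!: derivative_eq_intros
          simp: has_real_derivative_iff_has_vector_derivative[symmetric] cos_add sin_add)
  have "((\<lambda>\<alpha>. \<gamma> \<alpha> \<bullet> normal \<alpha>) has_vector_derivative
      \<gamma> \<alpha> \<bullet> normal (\<alpha> + pi / 2) + vector_derivative \<gamma> (at \<alpha>) \<bullet> normal \<alpha>) (at \<alpha>)"
    by (rule bounded_bilinear.has_vector_derivative[OF bounded_bilinear_inner d n])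
  moreover have "vector_derivative \<gamma> (at \<alpha>) \<bullet> normal \<alpha> = 0"
    using assms unfolding angle_curve_def by blast
  moreover have "support \<gamma> = (\<lambda>\<alpha>. \<gamma> \<alpha> \<bullet> normal \<alpha>)"
    by (auto simp: support_def)
  ultimately show ?thesis
    by (simp add: has_real_derivative_iff_has_vector_derivative)
qed

lemma curve_of_support_support:
  assumes "angle_curve \<gamma>"
  shows "curve_of_support (support \<gamma>) = \<gamma>"
proof
  fix \<alpha>
  obtain x y where xy: "\<gamma> \<alpha> = (x, y)" by (cases "\<gamma> \<alpha>")
  have d: "deriv (support \<gamma>) \<alpha> = \<gamma> \<alpha> \<bullet> normal (\<alpha> + pi / 2)"
    by (rule DERIV_imp_deriv[OF angle_curve_support_deriv[OF assms]])
  have c: "cos \<alpha> * cos \<alpha> = 1 - sin \<alpha> * sin \<alpha>"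
    using sin_cos_squared_add[of \<alpha>] by (simp add: power2_eq_square)
  show "curve_of_support (support \<gamma>) \<alpha> = \<gamma> \<alpha>"
    using xy by (auto simp: curve_of_support_def d support_def normal_def cos_add sin_add
        algebra_simps c) 
qed

lemma tangent_line_eq_normal_line_iff:
  "tangent_line \<epsilon> (\<alpha> + pi / 2) = normal_line \<gamma> \<alpha> \<longleftrightarrow>
     \<epsilon> (\<alpha> + pi / 2) \<bullet> normal (\<alpha> + pi / 2) = \<gamma> \<alpha> \<bullet> normal (\<alpha> + pi / 2)"
proof -
  let ?m = "normal (\<alpha> + pi / 2)"
  have c: "cos \<alpha> * cos \<alpha> = 1 - sin \<alpha> * sin \<alpha>"
    using sin_cos_squared_add[of \<alpha>] by (simp add: power2_eq_square)
  have nl: "normal_line \<gamma> \<alpha> = {x. (x - \<gamma> \<alpha>) \<bullet> ?m = 0}"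
  proof (rule set_eqI)
    fix x
    have "x \<in> normal_line \<gamma> \<alpha>" if h: "(x - \<gamma> \<alpha>) \<bullet> ?m = 0"
    proof -
      obtain u v where uv: "x - \<gamma> \<alpha> = (u, v)" by (cases "x - \<gamma> \<alpha>")
      have e: "v * cos \<alpha> = u * sin \<alpha>"
        using h uv by (simp add: normal_def cos_add sin_add)
      have "(u * cos \<alpha> + v * sin \<alpha>) * cos \<alpha> = u * (cos \<alpha> * cos \<alpha>) + (v * cos \<alpha>) * sin \<alpha>"
        by (simp add: algebra_simps)
      also have "\<dots> = u" by (simp add: c e algebra_simps)
      finally have e1: "(u * cos \<alpha> + v * sin \<alpha>) * cos \<alpha> = u" .
      have "(u * cos \<alpha> + v * sin \<alpha>) * sin \<alpha> = (u * sin \<alpha>) * cos \<alpha> + v * (sin \<alpha> * sin \<alpha>)"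
        by (simp add: algebra_simps)
      also have "\<dots> = v * (cos \<alpha> * cos \<alpha>) + v * (sin \<alpha> * sin \<alpha>)"
        by (simp add: e[symmetric])
      also have "\<dots> = v" by (simp add: c algebra_simps)
      finally have e2: "(u * cos \<alpha> + v * sin \<alpha>) * sin \<alpha> = v" .
      have "x - \<gamma> \<alpha> = (u * cos \<alpha> + v * sin \<alpha>) *\<^sub>R normal \<alpha>"
        using e1 e2 uv by (simp add: normal_def)
      then have "x = \<gamma> \<alpha> + (u * cos \<alpha> + v * sin \<alpha>) *\<^sub>R normal \<alpha>"
        by (simp add: algebra_simps)
      then show ?thesis unfolding normal_line_def by blast
    qed
    moreover have "(x - \<gamma> \<alpha>) \<bullet> ?m = 0" if "x \<in> normal_line \<gamma> \<alpha>"
      using that by (auto simp: normal_line_def normal_def cos_add sin_add)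
    ultimately show "x \<in> normal_line \<gamma> \<alpha> \<longleftrightarrow> x \<in> {x. (x - \<gamma> \<alpha>) \<bullet> ?m = 0}" by blast
  qed
  show ?thesis
    unfolding nl tangent_line_def
    by (simp add: inner_diff_left set_eq_iff) (metis prod.collapse)
qed

lemma is_evolute_iff_support:
  assumes "angle_curve \<gamma>" "angle_curve \<epsilon>"
  shows "is_evolute \<gamma> \<epsilon> \<longleftrightarrow>
    (\<forall>\<alpha>. support \<epsilon> \<alpha> = deriv (support \<gamma>) (\<alpha> - pi / 2))"
proof -
  have d: "deriv (support \<gamma>) \<alpha> = \<gamma> \<alpha> \<bullet> normal (\<alpha> + pi / 2)" for \<alpha>
    by (rule DERIV_imp_deriv[OF angle_curve_support_deriv[OF assms(1)]])
  have "is_evolute \<gamma> \<epsilon> \<longleftrightarrow> (\<forall>\<alpha>. support \<epsilon> (\<alpha> + pi / 2) = deriv (support \<gamma>) \<alpha>)"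
    using assms(2) by (simp add: is_evolute_def tangent_line_eq_normal_line_iff support_def d)
  also have "\<dots> \<longleftrightarrow> (\<forall>\<alpha>. support \<epsilon> \<alpha> = deriv (support \<gamma>) (\<alpha> - pi / 2))"
    by (metis add_diff_cancel_right' diff_add_cancel)
  finally show ?thesis .
qed

lemma cycloid_eq:
  "cycloid \<alpha> = (- \<alpha> + sin (2 * \<alpha>) / 2, - (1 + cos (2 * \<alpha>)) / 2)"
proof -
  have d: "deriv (\<lambda>\<alpha>. - (\<alpha> * cos \<alpha>)) \<alpha> = \<alpha> * sin \<alpha> - cos \<alpha>"
    by (rule DERIV_imp_deriv) (auto intro!: derivative_eq_intros)
  have c: "cos \<alpha> * cos \<alpha> = 1 - sin \<alpha> * sin \<alpha>"
    using sin_cos_squared_add[of \<alpha>] by (simp add: power2_eq_square)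
  have s2: "sin (\<alpha> * 2) = 2 * (sin \<alpha> * cos \<alpha>)" and c2: "cos (\<alpha> * 2) = 1 - 2 * (sin \<alpha> * sin \<alpha>)"
    using sin_double[of \<alpha>] cos_double[of \<alpha>] c by (simp_all add: power2_eq_square mult.commute)
  show ?thesis
    by (simp add: cycloid_def curve_of_support_def d field_simps c s2 c2)
qed

lemma angle_curve_translate_cycloid: "angle_curve (translate v cycloid)"
proof -
  define F :: "real \<times> real \<Rightarrow> real \<times> real \<Rightarrow> real \<times> real \<Rightarrow> real \<times> real \<Rightarrow> curve"
    where "F a b c d t = t *\<^sub>R a + b + sin (2 * t) *\<^sub>R c + cos (2 * t) *\<^sub>R d" for a b c d t
  have D: "(F a b c d has_vector_derivative F 0 a (- 2 *\<^sub>R d) (2 *\<^sub>R c) t) (at t)" for a b c d t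
    unfolding F_def
    by (auto intro!: derivative_eq_intros simp: algebra_simps)
  have V: "(\<lambda>t. vector_derivative (F a b c d) (at t)) = F 0 a (- 2 *\<^sub>R d) (2 *\<^sub>R c)" for a b c d
    by (rule ext, rule vector_derivative_at, rule D)
  have I: "\<exists>a' b' c' d'. ((\<lambda>g t. vector_derivative g (at t)) ^^ n) (F a b c d) = F a' b' c' d'"
    for n a b c d
  proof (induction n)
    case 0
    show ?case by (metis funpow_0)
  next
    case (Suc n)
    then show ?case by (metis V funpow.simps(2) comp_apply)
  qed
  have S: "smooth (F a b c d)" for a b c d
    unfolding smooth_def using I D by (metis differentiableI_vector)
  have T: "translate v cycloid = F (-1, 0) ((0, -1/2) + v) (1/2, 0) (0, -1/2)"
    by (rule ext) (auto simp: translate_def cycloid_eq F_def prod_eq_iff field_simps)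
  have c: "cos \<alpha> * cos \<alpha> = 1 - sin \<alpha> * sin \<alpha>" for \<alpha> :: real
    using sin_cos_squared_add[of \<alpha>] by (simp add: power2_eq_square)
  have "F 0 (-1, 0) (- 2 *\<^sub>R (0, -1/2)) (2 *\<^sub>R (1/2, 0)) \<alpha> \<bullet> normal \<alpha> = 0" for \<alpha>
  proof -
    have s2: "sin (\<alpha> * 2) = 2 * (sin \<alpha> * cos \<alpha>)" and c2: "cos (\<alpha> * 2) = 1 - 2 * (sin \<alpha> * sin \<alpha>)"
      using sin_double[of \<alpha>] cos_double[of \<alpha>] c
      by (simp_all add: power2_eq_square mult.commute)
    show ?thesis
      by (simp add: F_def normal_def mult.commute[of 2 \<alpha>] s2 c2 algebra_simps)
  qed
  then show ?thesis
    unfolding angle_curve_def T using S by (simp add: vector_derivative_at[OF D])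
qed

lemma cycloid_evolute: "is_evolute cycloid (translate drift cycloid)"
proof -
  have "translate drift cycloid (\<alpha> + pi / 2) \<bullet> normal (\<alpha> + pi / 2) =
      cycloid \<alpha> \<bullet> normal (\<alpha> + pi / 2)" for \<alpha>
  proof -
    have c: "cos \<alpha> * cos \<alpha> = 1 - sin \<alpha> * sin \<alpha>"
      using sin_cos_squared_add[of \<alpha>] by (simp add: power2_eq_square)
    have s2: "sin (\<alpha> * 2) = 2 * (sin \<alpha> * cos \<alpha>)" and c2: "cos (\<alpha> * 2) = 1 - 2 * (sin \<alpha> * sin \<alpha>)"
      using sin_double[of \<alpha>] cos_double[of \<alpha>] c by (simp_all add: power2_eq_square mult.commute)
    have m: "normal (\<alpha> + pi / 2) = (- sin \<alpha>, cos \<alpha>)"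
      by (simp add: normal_def cos_add sin_add)
    have t: "translate drift cycloid (\<alpha> + pi / 2) =
        (- \<alpha> - sin (\<alpha> * 2) / 2, (cos (\<alpha> * 2) - 1) / 2 - 1)"
      by (simp add: translate_def drift_def cycloid_eq distrib_left mult.commute[of 2 \<alpha>])
    have "cycloid \<alpha> = (- \<alpha> + sin (\<alpha> * 2) / 2, - (1 + cos (\<alpha> * 2)) / 2)"
      by (simp add: cycloid_eq mult.commute)
    then show ?thesis
      unfolding t m by (simp add: s2 c2 algebra_simps add_divide_distrib diff_divide_distrib)
  qed
  then show ?thesis
    unfolding is_evolute_def tangent_line_eq_normal_line_iff
    using angle_curve_translate_cycloid by blast
qed

end

theory Submission
  imports Defs
begin

text \<open>
  Measured relative to the cycloid, whose evolute is its translate by \<open>drift\<close>, an involution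
  step turns the periodic part \<open>f\<close> into the mean-zero \<open>g\<close> with \<open>g' \<alpha> = f (\<alpha> + pi / 2)\<close>. This step
  fixes the first harmonics, which are exactly the support functions of points, hence a
  translation removes them once and for all. On functions orthogonal to \<open>1\<close>, \<open>cos\<close> and
  \<open>sin\<close> the step contracts the supremum norm by the factor \<open>pi / 2 - 2 / pi < 1\<close>. The derivative of
  an iterate is a shift of the preceding iterate, so the curves themselves converge uniformly.

  If the evolute of \<open>\<gamma>\<close> is \<open>\<gamma> + u\<close>, the iterated involutes are \<open>\<gamma> - n u\<close>; their convergence after
  undoing the drift forces \<open>u = drift\<close>, and then \<open>\<gamma>\<close> equals its own limit, a translated cycloid.
\<close>

subsection \<open>Periodic functions and first harmonics\<close>

lemma has_vector_derivative_shift: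
  assumes "(f has_vector_derivative f') (at (t + c))"
  shows "((\<lambda>s. f (s + c)) has_vector_derivative f') (at t)"
proof -
  have "((\<lambda>s. s + c) has_vector_derivative 1) (at t)"
    by (auto intro!: derivative_eq_intros)
  from vector_diff_chain_at[OF this assms] show ?thesis
    by (simp add: o_def)
qed

lemma normal_has_vector_derivative:
  "(normal has_vector_derivative normal (t + pi / 2)) (at t)"
  unfolding normal_def
  by (rule has_vector_derivative_eq_rhs, rule has_vector_derivative_Pair)
    (auto intro!: derivative_eq_intros
      simp: has_real_derivative_iff_has_vector_derivative[symmetric] cos_add sin_add)

lemma continuous_on_normal: "continuous_on S normal"
  by (auto simp: normal_def [abs_def] intro!: continuous_intros)

lemma normal_add_pi: "normal (t + pi) = - normal t"
  by (simp add: normal_def)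

lemma normal_add_2pi: "normal (t + 2 * pi) = normal t"
  by (simp add: normal_def)

lemma normal_inner_normal: "normal s \<bullet> normal t = cos (s - t)"
  by (simp add: normal_def cos_diff)

text \<open>The normals at \<open>t\<close> and \<open>t + pi / 2\<close> are an orthonormal basis.
  Support functions control a curve only through inner products with these two vectors; the
  expansion turns such scalar facts into facts about points.\<close>

lemma normal_frame: "x = (x \<bullet> normal t) *\<^sub>R normal t + (x \<bullet> normal (t + pi / 2)) *\<^sub>R normal (t + pi / 2)"
proof -
  have c: "cos t * cos t = 1 - sin t * sin t"
    using sin_cos_squared_add[of t] by (simp add: power2_eq_square)
  show ?thesis
    by (cases x) (simp add: normal_def cos_add sin_add algebra_simps c)
qed

lemma norm_normal: "norm (normal t) = 1"
  by (simp add: norm_eq_sqrt_inner normal_inner_normal)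

lemma scaleR_normal_has_vector_derivative:
  assumes "(g has_vector_derivative g') (at t)"
  shows "((\<lambda>t. g t *\<^sub>R normal (t + c)) has_vector_derivative
    g t *\<^sub>R normal (t + c + pi / 2) + g' *\<^sub>R normal (t + c)) (at t)"
  by (rule bounded_bilinear.has_vector_derivative[OF bounded_bilinear_scaleR assms
        has_vector_derivative_shift[OF normal_has_vector_derivative]])

section \<open>Primitives and integrals of periodic functions\<close>

lemma antiderivative_exists:
  fixes f :: "real \<Rightarrow> 'a::euclidean_space"
  assumes "continuous_on UNIV f"
  obtains F where "\<And>x. (F has_vector_derivative f x) (at x)"
proof -
  \<comment> \<open>Taking the interval from minus infinity to infinity yields a primitive on the
    whole line at once, with no base point to choose.\<close>
  have "\<exists>F. \<forall>x::real. - \<infinity> < ereal x \<longrightarrow> ereal x < \<infinity> \<longrightarrow> (F has_vector_derivative f x) (at x)"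
    by (rule einterval_antiderivative) (use assms in \<open>simp_all add: continuous_on_eq_continuous_at\<close>)
  then show ?thesis
    using that by (auto simp del: less_ereal.simps)
qed

lemma has_integral_antiderivative:
  fixes f :: "real \<Rightarrow> 'a::banach"
  assumes "\<And>x. (F has_vector_derivative f x) (at x)" "a \<le> b"
  shows "(f has_integral F b - F a) {a..b}"
  by (rule fundamental_theorem_of_calculus[OF assms(2)]) (rule has_vector_derivative_at_within[OF assms(1)])

text \<open>The increment of \<open>F\<close> over one period has derivative zero, so it is
  constant, and at \<open>0\<close> it is the integral over the period. A primitive of a mean-zero
  periodic function is thus periodic.\<close>

lemma periodic_antiderivative:
  fixes f :: "real \<Rightarrow> 'a::euclidean_space"
  assumes F: "\<And>x. (F has_vector_derivative f x) (at x)"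
    and per: "\<And>x. f (x + T) = f x" and "0 \<le> T"
  shows "F (x + T) = F x + integral {0..T} f"
proof -
  have "((\<lambda>x. F (x + T) - F x) has_vector_derivative 0) (at x within UNIV)" for x
    using has_vector_derivative_diff[OF has_vector_derivative_shift[OF F[of "x + T"]] F[of x]]
    by (simp add: per)
  then obtain c where c: "\<And>x. F (x + T) - F x = c"
    by (rule has_vector_derivative_zero_constant[OF convex_UNIV]) auto
  have "integral {0..T} f = F (0 + T) - F 0"
    using has_integral_antiderivative[OF F \<open>0 \<le> T\<close>] by (simp add: integral_unique)
  then show ?thesis
    using c[of x] c[of 0] by (simp add: diff_eq_eq add.commute)
qed

lemma periodic_has_integral:
  fixes f :: "real \<Rightarrow> 'a::euclidean_space"
  assumes "continuous_on UNIV f" and per: "\<And>x. f (x + T) = f x" and "0 \<le> T"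
  shows "(f has_integral integral {0..T} f) {a..a + T}"
proof -
  obtain F where F: "\<And>x. (F has_vector_derivative f x) (at x)"
    using antiderivative_exists[OF assms(1)] by blast
  show ?thesis
    using has_integral_antiderivative[OF F, of a "a + T"] \<open>0 \<le> T\<close>
      periodic_antiderivative[OF F per \<open>0 \<le> T\<close>, of a]
    by simp
qed

lemma periodic_shift_has_integral:
  fixes f :: "real \<Rightarrow> 'a::euclidean_space"
  assumes "continuous_on UNIV f" and per: "\<And>x. f (x + T) = f x" and "0 \<le> T"
  shows "((\<lambda>t. f (t + c)) has_integral integral {0..T} f) {0..T}"
proof -
  obtain F where F: "\<And>x. (F has_vector_derivative f x) (at x)"
    using antiderivative_exists[OF assms(1)] by blast
  show ?thesis
    using has_integral_antiderivative[OF has_vector_derivative_shift[OF F], of 0 T c] \<open>0 \<le> T\<close>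
      periodic_antiderivative[OF F per \<open>0 \<le> T\<close>, of c]
    by (simp add: add.commute)
qed

lemma periodic_bounded:
  fixes f :: "real \<Rightarrow> 'a::real_normed_vector"
  assumes "continuous_on UNIV f" and per: "\<And>x. f (x + T) = f x" and "0 < T"
  obtains M where "\<And>x. norm (f x) \<le> M"
proof -
  have "compact (f ` {0..T})"
    using assms(1) by (intro compact_continuous_image) (auto intro: continuous_on_subset)
  then obtain M where M: "\<And>x. x \<in> {0..T} \<Longrightarrow> norm (f x) \<le> M"
    by (meson compact_imp_bounded bounded_iff imageI)
  have n: "f (x + real n * T) = f x" for n x
  proof (induction n)
    case (Suc n)
    have "f (x + real (Suc n) * T) = f ((x + real n * T) + T)" by (simp add: algebra_simps)
    then show ?case using Suc per by simp
  qed simp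
  have "norm (f x) \<le> M" for x
  proof -
    define k where "k = \<lfloor>x / T\<rfloor>"
    have k: "0 \<le> x - k * T" "x - k * T \<le> T"
      using floor_divide_lower[OF \<open>0 < T\<close>, of x] floor_divide_upper[OF \<open>0 < T\<close>, of x]
      by (simp_all add: k_def algebra_simps)
    \<comment> \<open>Only natural multiples of \<open>T\<close> are covered by \<open>n\<close>, so
      for negative \<open>k\<close> the shift is made from \<open>x\<close> instead.\<close>
    have "f (x - k * T) = f x"
    proof (cases "k \<ge> 0")
      case True
      then show ?thesis using n[of "x - k * T" "nat k"] by simp
    next
      case False
      then show ?thesis using n[of x "nat (- k)"] by simp
    qed
    then show ?thesis using M[of "x - k * T"] k by simp
  qed
  then show ?thesis by (rule that)
qed

text \<open>
  Integrating by parts against the sawtooth kernel \<open>s\<close> on \<open>[-pi, pi]\<close> alone only gives the factor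
  \<open>pi / 2\<close>. Orthogonality to the first harmonics allows the kernel \<open>s - sin s\<close> instead, whose
  \<open>L\<^sup>1\<close> norm is below \<open>2 * pi\<close>.
\<close>

lemma orthogonal_primitive_bound:
  fixes g h :: "real \<Rightarrow> real"
  assumes g: "\<And>t. (g has_real_derivative h t) (at t)"
    and per: "\<And>t. g (t + 2 * pi) = g t"
    and mean: "integral {0..2 * pi} g = 0"
    and orth: "integral {0..2 * pi} (\<lambda>t. g t *\<^sub>R normal t) = 0"
    and M: "\<And>t. \<bar>h t\<bar> \<le> M"
  shows "\<bar>g x\<bar> \<le> (pi / 2 - 2 / pi) * M"
proof -
  \<comment> \<open>The window of length \<open>2 * pi\<close> centred at \<open>y\<close> ends at
    \<open>x\<close> and begins at \<open>x - 2 * pi\<close>, where \<open>g\<close> has the same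
    value. The kernel is \<open>pi\<close> at the right end and \<open>- pi\<close> at the left, so
    the boundary term is \<open>2 * pi * g x\<close>.\<close>
  define y where "y = x - pi"
  have gc: "continuous_on UNIV g"
    by (rule continuous_at_imp_continuous_on) (use g DERIV_isCont in blast)
  have "((\<lambda>t. ((t - y) - sin (t - y)) * g t) has_vector_derivative
      g t - cos (t - y) * g t + ((t - y) - sin (t - y)) * h t) (at t)" for t
    unfolding has_real_derivative_iff_has_vector_derivative[symmetric]
    by (auto intro!: derivative_eq_intros g simp: algebra_simps)
  from has_integral_antiderivative[OF this, of "y - pi" "y - pi + 2 * pi"]
  have 1: "((\<lambda>t. g t - cos (t - y) * g t + ((t - y) - sin (t - y)) * h t) has_integral 2 * pi * g x)
      {y - pi..y - pi + 2 * pi}"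
    using per[of "y - pi"] by (simp add: y_def algebra_simps)
  have 2: "(g has_integral 0) {y - pi..y - pi + 2 * pi}"
    using periodic_has_integral[OF gc per, of "y - pi"] mean by simp
  have "((\<lambda>t. g t *\<^sub>R normal t) has_integral 0) {y - pi..y - pi + 2 * pi}"
    using periodic_has_integral[of "\<lambda>t. g t *\<^sub>R normal t" "2 * pi" "y - pi"] orth
    by (simp add: per normal_add_2pi continuous_on_scaleR[OF gc continuous_on_normal])
  from has_integral_linear[OF this bounded_linear_inner_left[of "normal y"]]
  \<comment> \<open>The cosine is the inner product of \<open>normal t\<close> with the fixed vector
    \<open>normal y\<close>, so orthogonality to the first harmonics applies.\<close>
  have 3: "((\<lambda>t. cos (t - y) * g t) has_integral 0) {y - pi..y - pi + 2 * pi}"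
    by (simp add: o_def normal_inner_normal mult.commute)
  have 4: "((\<lambda>t. ((t - y) - sin (t - y)) * h t) has_integral 2 * pi * g x) {y - pi..y - pi + 2 * pi}"
    using has_integral_diff[OF 1 has_integral_diff[OF 2 3]] by simp
  \<comment> \<open>With \<open>s = t - y\<close>, the kernel \<open>s - sin s\<close> is odd and
    has the sign of \<open>s\<close>. Its absolute value is therefore integrated on the two halves
    separately, each contributing \<open>pi\<^sup>2 / 2 - 2\<close>.\<close>
  have kd: "((\<lambda>t. ((t - y)\<^sup>2 / 2 + cos (t - y)) * M) has_vector_derivative ((t - y) - sin (t - y)) * M) (at t)" for t
    unfolding has_real_derivative_iff_has_vector_derivative[symmetric]
    by (auto intro!: derivative_eq_intros simp: algebra_simps diff_divide_distrib)
  have "((\<lambda>t. ((t - y) - sin (t - y)) * M) has_integral (pi\<^sup>2 / 2 - 2) * M) {y..y + pi}"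
    using has_integral_antiderivative[OF kd, of y "y + pi"] by (simp add: algebra_simps)
  moreover have "((t - y) - sin (t - y)) * M = \<bar>(t - y) - sin (t - y)\<bar> * M" if "t \<in> {y..y + pi}" for t
    using sin_x_le_x[of "t - y"] that by simp
  ultimately have r: "((\<lambda>t. \<bar>(t - y) - sin (t - y)\<bar> * M) has_integral (pi\<^sup>2 / 2 - 2) * M) {y..y + pi}"
    by (rule has_integral_eq[rotated])
  have "((\<lambda>t. - (((t - y) - sin (t - y)) * M)) has_integral (pi\<^sup>2 / 2 - 2) * M) {y - pi..y}"
    using has_integral_neg[OF has_integral_antiderivative[OF kd, of "y - pi" y]]
    by (simp add: algebra_simps)
  moreover have "- (((t - y) - sin (t - y)) * M) = \<bar>(t - y) - sin (t - y)\<bar> * M" if "t \<in> {y - pi..y}" for t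
    using sin_x_le_x[of "y - t"] that by (simp add: sin_diff algebra_simps)
  ultimately have l: "((\<lambda>t. \<bar>(t - y) - sin (t - y)\<bar> * M) has_integral (pi\<^sup>2 / 2 - 2) * M) {y - pi..y}"
    by (rule has_integral_eq[rotated])
  have 5: "((\<lambda>t. \<bar>(t - y) - sin (t - y)\<bar> * M) has_integral (pi\<^sup>2 - 4) * M) {y - pi..y - pi + 2 * pi}"
    using has_integral_combine[OF _ _ l r] by (simp add: algebra_simps)
  have "norm (((t - y) - sin (t - y)) * h t) \<le> \<bar>(t - y) - sin (t - y)\<bar> * M" for t
    using M[of t] by (simp add: abs_mult mult_left_mono)
  then have "norm (2 * pi * g x) \<le> (pi\<^sup>2 - 4) * M"
    using integral_norm_bound_integral[OF has_integral_integrable[OF 4] has_integral_integrable[OF 5]]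
    unfolding integral_unique[OF 4] integral_unique[OF 5] by blast
  \<comment> \<open>Dividing \<open>pi\<^sup>2 - 4\<close> by \<open>2 * pi\<close> gives the
    contraction factor.\<close>
  then have "2 * pi * \<bar>g x\<bar> \<le> 2 * pi * ((pi / 2 - 2 / pi) * M)"
    by (simp add: abs_mult power2_eq_square algebra_simps)
  then show ?thesis
    by (simp only: mult_le_cancel_left_pos pi_gt_zero mult_pos_pos zero_less_numeral)
qed

lemma contraction_factor: "0 \<le> pi / 2 - 2 / pi" "pi / 2 - 2 / pi < 1"
proof -
  have "4 \<le> pi * pi" using mult_mono[of 2 pi 2 pi] pi_gt3 by simp
  then show "0 \<le> pi / 2 - 2 / pi" by (simp add: field_simps)
  \<comment> \<open>The factor is below 1 exactly when \<open>pi * (pi - 2) < 4\<close>; the crude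
    bound \<open>pi \<le> 3.2\<close> already gives 3.84.\<close>
  have "pi * (pi - 2) \<le> 3.2 * 1.2"
    by (rule mult_mono) (use pi_approx pi_gt3 in auto)
  then have "pi * pi < 4 + 2 * pi" by (simp add: algebra_simps)
  then show "pi / 2 - 2 / pi < 1" by (simp add: field_simps)
qed

section \<open>Integrals against the first harmonics\<close>

text \<open>Differentiating \<open>normal\<close> is a quarter turn, the same shift as in the
  argument of \<open>h\<close>. Hence the derivative of
  \<open>g t *\<^sub>R normal (t + pi / 2)\<close> is the shifted integrand for \<open>h\<close>
  minus the integrand for \<open>g\<close>, and it integrates to zero over a period.\<close>

lemma first_harmonic_invariant:
  fixes g h :: "real \<Rightarrow> real"
  assumes g: "\<And>t. (g has_real_derivative h (t + pi / 2)) (at t)" and h: "continuous_on UNIV h"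
    and per: "\<And>t. g (t + 2 * pi) = g t" "\<And>t. h (t + 2 * pi) = h t"
  shows "integral {0..2 * pi} (\<lambda>t. g t *\<^sub>R normal t) = integral {0..2 * pi} (\<lambda>t. h t *\<^sub>R normal t)"
proof -
  have "((\<lambda>t. g t *\<^sub>R normal (t + pi / 2)) has_vector_derivative
      h (t + pi / 2) *\<^sub>R normal (t + pi / 2) - g t *\<^sub>R normal t) (at t)" for t
    using scaleR_normal_has_vector_derivative[of g "h (t + pi / 2)" t "pi / 2"] g
    by (simp add: has_real_derivative_iff_has_vector_derivative normal_add_pi add.assoc)
  from has_integral_antiderivative[OF this, of 0 "2 * pi"]
  have 1: "((\<lambda>t. h (t + pi / 2) *\<^sub>R normal (t + pi / 2) - g t *\<^sub>R normal t) has_integral 0) {0..2 * pi}"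
    using per(1)[of 0] normal_add_2pi[of "pi / 2"] by simp
  have 2: "((\<lambda>t. h (t + pi / 2) *\<^sub>R normal (t + pi / 2)) has_integral
      integral {0..2 * pi} (\<lambda>t. h t *\<^sub>R normal t)) {0..2 * pi}"
    by (rule periodic_shift_has_integral)
      (simp_all add: per normal_add_2pi continuous_on_scaleR[OF h continuous_on_normal])
  show ?thesis
    using has_integral_diff[OF 2 1] by (simp add: integral_unique)
qed

lemma has_integral_inner_normal: "((\<lambda>t. v \<bullet> normal t) has_integral 0) {0..2 * pi}"
proof -
  have "((\<lambda>t. - (v \<bullet> normal (t + pi / 2))) has_vector_derivative v \<bullet> normal t) (at t)" for t
    by (rule has_vector_derivative_eq_rhs, rule has_vector_derivative_minus,
        rule bounded_linear.has_vector_derivative[OF bounded_linear_inner_right],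
        rule has_vector_derivative_shift[OF normal_has_vector_derivative])
      (simp add: normal_add_pi add.assoc)
  from has_integral_antiderivative[OF this, of 0 "2 * pi"] show ?thesis
    using normal_add_2pi[of "pi / 2"] by simp
qed

text \<open>Projection onto a rotating direction averages to half the identity. The factor
  \<open>pi\<close> fixes the normalization of the translation vector that removes the first
  harmonics.\<close>

lemma has_integral_inner_normal_normal:
  "((\<lambda>t. (v \<bullet> normal t) *\<^sub>R normal t) has_integral pi *\<^sub>R v) {0..2 * pi}"
proof -
  \<comment> \<open>Write \<open>v\<close> as \<open>?A + ?B\<close>, its components along the two
    frame vectors. The subtracted product has derivative \<open>?B - ?A\<close>, so the bracket has
    derivative \<open>2 *\<^sub>R ?A\<close>.\<close>
  have d: "((\<lambda>t. (1 / 2) *\<^sub>R (t *\<^sub>R v - (v \<bullet> normal t) *\<^sub>R normal (t + pi / 2)))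
      has_vector_derivative (v \<bullet> normal t) *\<^sub>R normal t) (at t)" for t
  proof -
    have "((\<lambda>t. v \<bullet> normal t) has_vector_derivative v \<bullet> normal (t + pi / 2)) (at t)"
      by (rule bounded_linear.has_vector_derivative[OF bounded_linear_inner_right
            normal_has_vector_derivative])
    from scaleR_normal_has_vector_derivative[OF this, of "pi / 2"]
    have a: "((\<lambda>t. (v \<bullet> normal t) *\<^sub>R normal (t + pi / 2)) has_vector_derivative
        (v \<bullet> normal (t + pi / 2)) *\<^sub>R normal (t + pi / 2) - (v \<bullet> normal t) *\<^sub>R normal t) (at t)"
      by (simp add: normal_add_pi add.assoc)
    have b: "((\<lambda>t. t *\<^sub>R v) has_vector_derivative v) (at t)"
      by (auto intro!: derivative_eq_intros)
    have "v - ((v \<bullet> normal (t + pi / 2)) *\<^sub>R normal (t + pi / 2) - (v \<bullet> normal t) *\<^sub>R normal t)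
        = 2 *\<^sub>R ((v \<bullet> normal t) *\<^sub>R normal t)"
      (is "v - (?B - ?A) = _")
    proof -
      \<comment> \<open>Only the leading \<open>v\<close> is expanded in the frame; the occurrences
        inside \<open>?A\<close> and \<open>?B\<close> stay.\<close>
      have "v - (?B - ?A) = (?A + ?B) - (?B - ?A)"
        by (rule arg_cong[OF normal_frame])
      also have "\<dots> = 2 *\<^sub>R ?A"
        unfolding scaleR_2 by (simp only: algebra_simps)
      finally show ?thesis .
    qed
    with bounded_linear.has_vector_derivative[OF bounded_linear_scaleR_right[of "1 / 2"]
        has_vector_derivative_diff[OF b a]]
    show ?thesis by simp
  qed
  from has_integral_antiderivative[OF d, of 0 "2 * pi"] show ?thesis
    using normal_add_2pi[of "pi / 2"] normal_add_2pi[of 0] by (simp add: scaleR_diff_right)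
qed

subsection \<open>Smoothness and support functions\<close>

text \<open>Derivatives appear as existential witnesses, so closure under sums, products, shifts and
  primitives follows by induction without computing iterated \<open>vector_derivative\<close>
  terms.\<close>

primrec times_differentiable :: "nat \<Rightarrow> (real \<Rightarrow> 'a::real_normed_vector) \<Rightarrow> bool" where
  "times_differentiable 0 f = True"
| "times_differentiable (Suc k) f =
    (\<exists>f'. (\<forall>t. (f has_vector_derivative f' t) (at t)) \<and> times_differentiable k f')"

lemma times_differentiable_SucI:
  "(\<And>t. (f has_vector_derivative f' t) (at t)) \<Longrightarrow> times_differentiable k f' \<Longrightarrow>
    times_differentiable (Suc k) f"
  by auto

text \<open>Uniqueness of derivatives forces the witness to be \<open>vector_derivative\<close>, so
  one layer can be peeled off from the inside. The index is \<open>Suc k\<close> because the iterate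
  \<open>0\<close> already accounts for one differentiation.\<close>

lemma times_differentiable_Suc_iff:
  "times_differentiable (Suc k) f \<longleftrightarrow>
    (\<forall>n\<le>k. \<forall>t. ((\<lambda>g t. vector_derivative g (at t)) ^^ n) f differentiable (at t))"
proof (induction k arbitrary: f)
  case 0
  have "(\<exists>f'. \<forall>t. (f has_vector_derivative f' t) (at t)) \<longleftrightarrow> (\<forall>t. f differentiable (at t))"
    by (auto simp: vector_derivative_works intro: vector_derivative_at[THEN ssubst])
  then show ?case by simp
next
  case (Suc k)
  let ?D = "\<lambda>g t. vector_derivative g (at t)"
  have "times_differentiable (Suc (Suc k)) f \<longleftrightarrow>
      (\<forall>t. f differentiable (at t)) \<and> times_differentiable (Suc k) (?D f)"
  proof
    assume "times_differentiable (Suc (Suc k)) f"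
    then obtain f' where f': "\<And>t. (f has_vector_derivative f' t) (at t)"
      and s: "times_differentiable (Suc k) f'"
      by (subst (asm) times_differentiable.simps(2)) blast
    have "f' = ?D f" by (rule ext) (simp add: vector_derivative_at[OF f'])
    then show "(\<forall>t. f differentiable (at t)) \<and> times_differentiable (Suc k) (?D f)"
      using s f' differentiableI_vector by blast
  next
    assume "(\<forall>t. f differentiable (at t)) \<and> times_differentiable (Suc k) (?D f)"
    then show "times_differentiable (Suc (Suc k)) f"
      by (subst times_differentiable.simps(2)) (auto simp: vector_derivative_works simp del: times_differentiable.simps)
  qed
  also have "\<dots> \<longleftrightarrow> (\<forall>t. f differentiable (at t)) \<and> (\<forall>n\<le>k. \<forall>t. (?D ^^ Suc n) f differentiable (at t))"
    by (simp only: Suc.IH funpow_Suc_right comp_apply)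
  also have "\<dots> \<longleftrightarrow> (\<forall>n\<le>Suc k. \<forall>t. (?D ^^ n) f differentiable (at t))"
  proof -
    have "(\<forall>n\<le>Suc k. P n) \<longleftrightarrow> P 0 \<and> (\<forall>n\<le>k. P (Suc n))" for P
      by (metis Suc_le_mono less_eq_nat.simps(1) not0_implies_Suc)
    from this[of "\<lambda>n. \<forall>t. (?D ^^ n) f differentiable (at t)"] show ?thesis by simp
  qed
  finally show ?case .
qed

lemma times_differentiable_mono: "times_differentiable (Suc k) f \<Longrightarrow> times_differentiable k f"
proof (induction k arbitrary: f)
  case (Suc k)
  from Suc.prems obtain f' where "\<And>t. (f has_vector_derivative f' t) (at t)" "times_differentiable (Suc k) f'"
    by (subst (asm) times_differentiable.simps(2)) blast
  then show ?case using Suc.IH by auto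
qed simp

lemma smooth_iff: "smooth \<gamma> \<longleftrightarrow> (\<forall>k. times_differentiable k \<gamma>)"
proof -
  have "smooth \<gamma> \<longleftrightarrow> (\<forall>k. times_differentiable (Suc k) \<gamma>)"
    unfolding smooth_def times_differentiable_Suc_iff by auto
  then show ?thesis using times_differentiable_mono by blast
qed

lemma times_differentiable_derivative:
  assumes "\<And>k. times_differentiable k f" "\<And>t. (f has_vector_derivative f' t) (at t)"
  shows "times_differentiable k f'"
proof -
  obtain g where "\<And>t. (f has_vector_derivative g t) (at t)" "times_differentiable k g"
    using assms(1)[of "Suc k"] by auto
  moreover from this assms(2) have "g = f'"
    using vector_derivative_unique_at by blast
  ultimately show ?thesis by simp
qed

lemma times_differentiable_antiderivative:
  assumes "\<And>k. times_differentiable k f'" "\<And>t. (f has_vector_derivative f' t) (at t)"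
  shows "times_differentiable k f"
  using assms by (cases k) auto

lemma times_differentiable_add:
  "times_differentiable k f \<Longrightarrow> times_differentiable k g \<Longrightarrow> times_differentiable k (\<lambda>t. f t + g t)"
proof (induction k arbitrary: f g)
  case (Suc k)
  then obtain f' g' where "\<And>t. (f has_vector_derivative f' t) (at t)" "times_differentiable k f'"
    "\<And>t. (g has_vector_derivative g' t) (at t)" "times_differentiable k g'"
    by auto
  then show ?case
    by (intro times_differentiable_SucI[OF has_vector_derivative_add] Suc.IH)
qed simp

text \<open>The product rule, once for both inner products and scalar multiples. Its right-hand side
  still contains \<open>f\<close> and \<open>g\<close> themselves, hence the appeal to monotonicity
  in \<open>k\<close>.\<close>

lemma times_differentiable_bilinear:
  assumes "bounded_bilinear B"
  shows "times_differentiable k f \<Longrightarrow> times_differentiable k g \<Longrightarrow> times_differentiable k (\<lambda>t. B (f t) (g t))"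
proof (induction k arbitrary: f g)
  case (Suc k)
  then obtain f' g' where d: "\<And>t. (f has_vector_derivative f' t) (at t)" "times_differentiable k f'"
    "\<And>t. (g has_vector_derivative g' t) (at t)" "times_differentiable k g'"
    by auto
  have "times_differentiable k f" "times_differentiable k g"
    using Suc.prems times_differentiable_mono by blast+
  then have "times_differentiable k (\<lambda>t. B (f t) (g' t) + B (f' t) (g t))"
    using d Suc.IH by (intro times_differentiable_add)
  then show ?case
    by (rule times_differentiable_SucI[OF bounded_bilinear.has_vector_derivative[OF assms d(1) d(3)]])
qed simp

lemma times_differentiable_shift:
  "times_differentiable k f \<Longrightarrow> times_differentiable k (\<lambda>t. f (t + c))"
proof (induction k arbitrary: f)
  case (Suc k)
  then obtain f' where "\<And>t. (f has_vector_derivative f' t) (at t)" "times_differentiable k f'"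
    by auto
  then show ?case
    by (intro times_differentiable_SucI[OF has_vector_derivative_shift Suc.IH])
qed simp

lemma times_differentiable_const: "times_differentiable k (\<lambda>_. c)"
  by (induction k arbitrary: c) (auto intro!: exI[of _ "\<lambda>_. 0"])

lemma times_differentiable_normal: "times_differentiable k (\<lambda>t. normal (t + c))"
proof (induction k arbitrary: c)
  case (Suc k)
  have "((\<lambda>t. normal (t + c)) has_vector_derivative normal (t + (c + pi / 2))) (at t)" for t
    using has_vector_derivative_shift[OF normal_has_vector_derivative] by (simp add: add.assoc)
  then show ?case
    using Suc.IH by (rule times_differentiable_SucI)
qed simp

lemma times_differentiable_support:
  assumes "angle_curve \<gamma>"
  shows "times_differentiable k (support \<gamma>)"
proof -
  have "times_differentiable k (\<lambda>t. \<gamma> t \<bullet> normal (t + 0))"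
    using assms by (intro times_differentiable_bilinear[OF bounded_bilinear_inner] times_differentiable_normal)
      (simp add: angle_curve_def smooth_iff)
  then show ?thesis by (simp add: support_def[abs_def])
qed

section \<open>Curves and their support functions\<close>

lemma curve_of_support_eq:
  "curve_of_support p t = p t *\<^sub>R normal t + deriv p t *\<^sub>R normal (t + pi / 2)"
  by (simp add: curve_of_support_def normal_def cos_add sin_add)

lemma support_curve_of_support: "support (curve_of_support p) = p"
  by (rule ext) (simp add: support_def curve_of_support_eq inner_add_left normal_inner_normal)

text \<open>In the velocity the two terms \<open>p'\<close> along the normal cancel, leaving
  \<open>p + p''\<close> times the unit tangent; this is orthogonal to the normal also at
  cusps.\<close>

lemma angle_curve_curve_of_support:
  assumes "\<And>k. times_differentiable k p"
  shows "angle_curve (curve_of_support p)"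
proof -
  have d: "(p has_vector_derivative deriv p t) (at t)" for t
  proof -
    obtain p' where p': "\<And>t. (p has_vector_derivative p' t) (at t)"
      using assms[of "Suc 0"] by auto
    then have "deriv p t = p' t"
      by (intro DERIV_imp_deriv) (simp add: has_real_derivative_iff_has_vector_derivative)
    then show ?thesis using p' by simp
  qed
  have s1: "times_differentiable k (deriv p)" for k
    by (rule times_differentiable_derivative[OF assms d])
  obtain q where q: "\<And>t. (deriv p has_vector_derivative q t) (at t)"
    using s1[of "Suc 0"] by auto
  have e: "curve_of_support p = (\<lambda>t. p t *\<^sub>R normal (t + 0) + deriv p t *\<^sub>R normal (t + pi / 2))"
    by (rule ext) (simp add: curve_of_support_eq)
  have "times_differentiable k (curve_of_support p)" for k
    unfolding e by (intro times_differentiable_add times_differentiable_bilinear[OF bounded_bilinear_scaleR]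
        times_differentiable_normal assms s1)
  moreover have "vector_derivative (curve_of_support p) (at t) \<bullet> normal t = 0" for t
  proof -
    have "(curve_of_support p has_vector_derivative
        (p t *\<^sub>R normal (t + 0 + pi / 2) + deriv p t *\<^sub>R normal (t + 0)) +
        (deriv p t *\<^sub>R normal (t + pi / 2 + pi / 2) + q t *\<^sub>R normal (t + pi / 2))) (at t)"
      unfolding e by (intro has_vector_derivative_add scaleR_normal_has_vector_derivative d q)
    then show ?thesis
      by (simp add: vector_derivative_at inner_add_left normal_inner_normal)
  qed
  ultimately show ?thesis
    by (simp add: angle_curve_def smooth_iff)
qed

lemma angle_curve_translate:
  assumes "angle_curve \<gamma>"
  shows "angle_curve (translate v \<gamma>)"
proof -
  have s: "times_differentiable k \<gamma>" for k
    using assms by (simp add: angle_curve_def smooth_iff)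
  obtain \<gamma>' where d: "\<And>t. (\<gamma> has_vector_derivative \<gamma>' t) (at t)"
    using s[of "Suc 0"] by auto
  have "(translate v \<gamma> has_vector_derivative \<gamma>' t) (at t)" for t
    unfolding translate_def using has_vector_derivative_add[OF d has_vector_derivative_const] by simp
  then have "vector_derivative (translate v \<gamma>) (at t) = vector_derivative \<gamma> (at t)" for t
    using d vector_derivative_at by metis
  moreover have "times_differentiable k (translate v \<gamma>)" for k
    unfolding translate_def by (intro times_differentiable_add s times_differentiable_const)
  ultimately show ?thesis
    using assms by (simp add: angle_curve_def smooth_iff)
qed

section \<open>Periodic parts measured against the cycloid\<close>

lemma support_cycloid: "support cycloid t = - t * cos t"
  by (simp add: cycloid_def support_curve_of_support)

lemma support_translate: "support (translate v \<gamma>) t = support \<gamma> t + v \<bullet> normal t"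
  by (simp add: support_def translate_def inner_add_left)

text \<open>The periodic part is the difference of the support functions of \<gamma> and the
  cycloid, so the derivative formula for support functions applies to both.\<close>

lemma angle_curve_periodic_part:
  assumes "angle_curve \<gamma>"
  shows "(periodic_part \<gamma> has_real_derivative (\<gamma> t - cycloid t) \<bullet> normal (t + pi / 2)) (at t)"
proof -
  have "angle_curve cycloid"
    using angle_curve_translate_cycloid[of 0] by (simp add: translate_def)
  from DERIV_diff[OF angle_curve_support_deriv[OF assms] angle_curve_support_deriv[OF this]]
  show ?thesis
    by (simp add: periodic_part_def[abs_def] support_cycloid inner_diff_left)
qed

lemma continuous_on_periodic_part:
  "angle_curve \<gamma> \<Longrightarrow> continuous_on S (periodic_part \<gamma>)"
  by (rule continuous_at_imp_continuous_on) (use angle_curve_periodic_part DERIV_isCont in blast)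

text \<open>For the converse, the periodic part and its derivative are the two frame components of
  \<open>\<gamma> t - cycloid t\<close>. Both are periodic, hence so is this difference, and the
  cycloid itself moves by \<open>(2 * pi, 0)\<close> in each turn.\<close>

lemma periodic_part_periodic_iff:
  assumes "angle_curve \<gamma>"
  shows "(\<forall>t. \<gamma> (t + 2 * pi) = \<gamma> t - (2 * pi, 0)) \<longleftrightarrow>
    (\<forall>t. periodic_part \<gamma> (t + 2 * pi) = periodic_part \<gamma> t)"
proof
  assume "\<forall>t. \<gamma> (t + 2 * pi) = \<gamma> t - (2 * pi, 0)"
  then show "\<forall>t. periodic_part \<gamma> (t + 2 * pi) = periodic_part \<gamma> t"
    by (simp add: periodic_part_def support_def normal_add_2pi inner_diff_left) (simp add: normal_def algebra_simps)
next
  assume per: "\<forall>t. periodic_part \<gamma> (t + 2 * pi) = periodic_part \<gamma> t"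
  show "\<forall>t. \<gamma> (t + 2 * pi) = \<gamma> t - (2 * pi, 0)"
  proof
    fix t
    let ?D = "\<lambda>t. \<gamma> t - cycloid t"
    have 1: "?D t \<bullet> normal t = periodic_part \<gamma> t" for t
      by (simp add: periodic_part_def inner_diff_left flip: support_def) (simp add: support_cycloid)
    have 2: "?D (t + 2 * pi) \<bullet> normal (t + pi / 2) = ?D t \<bullet> normal (t + pi / 2)"
    proof (rule DERIV_unique)
      show "(periodic_part \<gamma> has_real_derivative ?D t \<bullet> normal (t + pi / 2)) (at t)"
        by (rule angle_curve_periodic_part[OF assms])
      have "((\<lambda>t. periodic_part \<gamma> (t + 2 * pi)) has_real_derivative
          ?D (t + 2 * pi) \<bullet> normal (t + 2 * pi + pi / 2)) (at t)"
        using angle_curve_periodic_part[OF assms, of "t + 2 * pi"] by (simp add: DERIV_shift)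
      moreover have "normal (t + 2 * pi + pi / 2) = normal (t + pi / 2)"
        using normal_add_2pi[of "t + pi / 2"] by (simp add: algebra_simps)
      ultimately show "(periodic_part \<gamma> has_real_derivative ?D (t + 2 * pi) \<bullet> normal (t + pi / 2)) (at t)"
        using per by simp
    qed
    have "?D (t + 2 * pi) \<bullet> normal t = ?D t \<bullet> normal t"
      using 1[of t] 1[of "t + 2 * pi"] per by (simp add: normal_add_2pi)
    with 2 have "?D (t + 2 * pi) = ?D t"
      by (subst (1 2) normal_frame[of _ t]) simp
    moreover have "cycloid (t + 2 * pi) = cycloid t - (2 * pi, 0)"
    proof -
      have "sin (2 * (t + 2 * pi)) = sin (2 * t)" "cos (2 * (t + 2 * pi)) = cos (2 * t)"
        by (simp_all only: sin_double cos_double sin_periodic cos_periodic)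
      then show ?thesis by (simp add: cycloid_eq)
    qed
    moreover have "\<gamma> (t + 2 * pi) = ?D (t + 2 * pi) + cycloid (t + 2 * pi)"
      by simp
    ultimately show "\<gamma> (t + 2 * pi) = \<gamma> t - (2 * pi, 0)"
      by (simp only:) simp
  qed
qed

lemma cycloidal_iff:
  "\<gamma> \<in> cycloidal \<longleftrightarrow> angle_curve \<gamma> \<and>
    (\<forall>t. periodic_part \<gamma> (t + 2 * pi) = periodic_part \<gamma> t) \<and> integral {0..2 * pi} (periodic_part \<gamma>) = 0"
  using periodic_part_periodic_iff by (auto simp: cycloidal_def)

lemma periodic_part_translate:
  "periodic_part (translate v \<gamma>) = (\<lambda>t. periodic_part \<gamma> t + v \<bullet> normal t)"
  by (rule ext) (simp add: periodic_part_def support_translate)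

lemma translate_cycloidal:
  assumes "\<gamma> \<in> cycloidal"
  shows "translate v \<gamma> \<in> cycloidal"
proof -
  from assms have \<gamma>: "angle_curve \<gamma>" "\<And>t. periodic_part \<gamma> (t + 2 * pi) = periodic_part \<gamma> t"
    "integral {0..2 * pi} (periodic_part \<gamma>) = 0"
    by (auto simp: cycloidal_iff)
  have "(periodic_part \<gamma> has_integral 0) {0..2 * pi}"
    using integrable_integral[OF integrable_continuous_interval[OF continuous_on_periodic_part[OF \<gamma>(1)]],
        of 0 "2 * pi"] \<gamma>(3) by simp
  from has_integral_add[OF this has_integral_inner_normal[of v]] show ?thesis
    using \<gamma> by (simp add: cycloidal_iff angle_curve_translate periodic_part_translate normal_add_2pi
        integral_unique)
qed

lemma cycloid_cycloidal: "cycloid \<in> cycloidal"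
  using angle_curve_translate_cycloid[of 0]
  by (simp add: cycloidal_iff translate_def periodic_part_def[abs_def] support_cycloid)

text \<open>This form is linear in the pair of curves, so evolute relations can be translated and
  subtracted.\<close>

lemma is_evolute_iff_inner_normal:
  "is_evolute \<gamma> \<epsilon> \<longleftrightarrow> angle_curve \<epsilon> \<and>
    (\<forall>t. \<gamma> t \<bullet> normal (t + pi / 2) = support \<epsilon> (t + pi / 2))"
  by (auto simp: is_evolute_def tangent_line_eq_normal_line_iff support_def)

text \<open>Subtracting the relation between the cycloid and its evolute removes the nonperiodic
  terms; the drift survives only as a first harmonic.\<close>

lemma is_evolute_periodic_part:
  assumes "angle_curve \<gamma>" "is_evolute \<gamma> \<epsilon>"
  shows "(periodic_part \<gamma> has_real_derivative
    periodic_part \<epsilon> (t + pi / 2) - drift \<bullet> normal (t + pi / 2)) (at t)"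
proof -
  have "(\<gamma> t - cycloid t) \<bullet> normal (t + pi / 2) = 
      support \<epsilon> (t + pi / 2) - support (translate drift cycloid) (t + pi / 2)"
    using assms(2) cycloid_evolute by (simp add: is_evolute_iff_inner_normal inner_diff_left)
  also have "\<dots> = periodic_part \<epsilon> (t + pi / 2) - drift \<bullet> normal (t + pi / 2)"
    by (simp add: periodic_part_def support_translate support_cycloid algebra_simps)
  finally show ?thesis
    using angle_curve_periodic_part[OF assms(1), of t] by simp
qed

subsection \<open>Involutes\<close>

text \<open>The zero average of the periodic part of \<gamma> makes its primitive periodic, and the
  free constant of integration is used to give the involute zero average too.\<close>

lemma involute_exists:
  assumes "\<gamma> \<in> cycloidal"
  obtains \<iota> where "is_involute \<gamma> \<iota>"
proof -
  from assms have \<gamma>: "angle_curve \<gamma>" "\<And>t. periodic_part \<gamma> (t + 2 * pi) = periodic_part \<gamma> t"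
    "integral {0..2 * pi} (periodic_part \<gamma>) = 0"
    by (auto simp: cycloidal_iff)
  obtain F where F: "\<And>t. (F has_vector_derivative periodic_part \<gamma> t) (at t)"
    using antiderivative_exists[OF continuous_on_periodic_part[OF \<gamma>(1)]] by blast
  have Fper: "F (t + 2 * pi) = F t" for t
    using periodic_antiderivative[OF F \<gamma>(2), of t] \<gamma>(3) by simp
  \<comment> \<open>The mean over one period, subtracted in \<open>g\<close>, the intended periodic
    part of the involute.\<close>
  define c where "c = integral {0..2 * pi} (\<lambda>t. F (t + pi / 2) - drift \<bullet> normal t) / (2 * pi)"
  define g where "g t = F (t + pi / 2) - drift \<bullet> normal t - c" for t
  have dn: "((\<lambda>t. drift \<bullet> normal t) has_vector_derivative drift \<bullet> normal (t + pi / 2)) (at t)" for t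
    by (rule bounded_linear.has_vector_derivative[OF bounded_linear_inner_right
          normal_has_vector_derivative])
  have gd: "(g has_vector_derivative periodic_part \<gamma> (t + pi / 2) - drift \<bullet> normal (t + pi / 2)) (at t)" for t
    unfolding g_def
    using has_vector_derivative_diff[OF has_vector_derivative_diff[OF has_vector_derivative_shift[OF F] dn]
        has_vector_derivative_const[of c]] by simp
  have gper: "g (t + 2 * pi) = g t" for t
    using Fper[of "t + pi / 2"] by (simp add: g_def normal_add_2pi add.assoc add.commute[of "2 * pi"])
  have "continuous_on {0..2 * pi} (\<lambda>t. F (t + pi / 2) - drift \<bullet> normal t)"
    by (rule continuous_at_imp_continuous_on)
      (use has_vector_derivative_diff[OF has_vector_derivative_shift[OF F] dn]
        has_vector_derivative_continuous in blast)
  from has_integral_diff[OF integrable_integral[OF integrable_continuous_interval[OF this]]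
      has_integral_const_real[of c 0 "2 * pi"]]
  have gmean: "integral {0..2 * pi} g = 0"
    unfolding g_def by (simp add: integral_unique c_def)
  \<comment> \<open>Adding back the support function of the cycloid gives the support function of
    the involute. Its derivative is a shift of \<open>support \<gamma>\<close>, from which it
    inherits smoothness.\<close>
  define q where "q t = g t + support cycloid t" for t
  have cyc: "angle_curve cycloid"
    using cycloid_cycloidal by (simp add: cycloidal_iff)
  have qd: "(q has_vector_derivative support \<gamma> (t + pi / 2)) (at t)" for t
  proof -
    have "(support cycloid has_vector_derivative support (translate drift cycloid) (t + pi / 2)) (at t)"
      using angle_curve_support_deriv[OF cyc, of t] cycloid_evolute
      by (simp add: is_evolute_iff_inner_normal has_real_derivative_iff_has_vector_derivative)
    from has_vector_derivative_add[OF gd this] show ?thesis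
      unfolding q_def
      by (rule has_vector_derivative_eq_rhs)
        (simp add: periodic_part_def support_translate support_cycloid algebra_simps)
  qed
  have qs: "times_differentiable k q" for k
    by (rule times_differentiable_antiderivative[OF _ qd])
      (rule times_differentiable_shift[OF times_differentiable_support[OF \<gamma>(1)]])
  let ?\<iota> = "curve_of_support q"
  have \<iota>: "angle_curve ?\<iota>"
    by (rule angle_curve_curve_of_support[OF qs])
  have "periodic_part ?\<iota> = g"
    by (rule ext) (simp add: periodic_part_def support_curve_of_support q_def support_cycloid)
  then have "?\<iota> \<in> cycloidal"
    using \<iota> gper gmean by (simp add: cycloidal_iff)
  moreover have "deriv q t = support \<gamma> (t + pi / 2)" for t
    using qd by (intro DERIV_imp_deriv) (simp add: has_real_derivative_iff_has_vector_derivative)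
  then have "is_evolute ?\<iota> \<gamma>"
    by (simp add: is_evolute_iff_support[OF \<iota> \<gamma>(1)] support_curve_of_support)
  ultimately show ?thesis
    using that by (simp add: is_involute_def)
qed

text \<open>Two involutes have periodic parts with the same derivative; the constant difference
  vanishes by the zero averages, and the support function determines the curve.\<close>

lemma involute_unique:
  assumes "is_involute \<gamma> \<iota>\<^sub>1" "is_involute \<gamma> \<iota>\<^sub>2"
  shows "\<iota>\<^sub>1 = \<iota>\<^sub>2"
proof -
  have a: "angle_curve \<iota>\<^sub>1" "is_evolute \<iota>\<^sub>1 \<gamma>" "integral {0..2 * pi} (periodic_part \<iota>\<^sub>1) = 0"
    "angle_curve \<iota>\<^sub>2" "is_evolute \<iota>\<^sub>2 \<gamma>" "integral {0..2 * pi} (periodic_part \<iota>\<^sub>2) = 0"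
    using assms by (auto simp: is_involute_def cycloidal_iff)
  have "((\<lambda>t. periodic_part \<iota>\<^sub>1 t - periodic_part \<iota>\<^sub>2 t) has_real_derivative 0) (at t)" for t
    using DERIV_diff[OF is_evolute_periodic_part[OF a(1,2), of t] is_evolute_periodic_part[OF a(4,5), of t]]
    by simp
  then have c: "periodic_part \<iota>\<^sub>1 t - periodic_part \<iota>\<^sub>2 t = periodic_part \<iota>\<^sub>1 0 - periodic_part \<iota>\<^sub>2 0" (is "_ = ?c") for t
    by (intro DERIV_isconst_all[where f = "\<lambda>t. periodic_part \<iota>\<^sub>1 t - periodic_part \<iota>\<^sub>2 t", simplified]) simp
  have "integral {0..2 * pi} (\<lambda>t. periodic_part \<iota>\<^sub>1 t - periodic_part \<iota>\<^sub>2 t) = 0"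
    using a by (subst integral_diff) (auto intro!: integrable_continuous_interval continuous_on_periodic_part)
  then have "?c = 0" by (subst (asm) c) simp
  then have "support \<iota>\<^sub>1 t = support \<iota>\<^sub>2 t" for t
    using c[of t] by (simp add: periodic_part_def)
  then have "support \<iota>\<^sub>1 = support \<iota>\<^sub>2" ..
  then have "curve_of_support (support \<iota>\<^sub>1) = curve_of_support (support \<iota>\<^sub>2)"
    by (rule arg_cong)
  then show ?thesis
    by (simp only: curve_of_support_support a)
qed

lemma involute_eqI: "is_involute \<gamma> \<iota> \<Longrightarrow> involute \<gamma> = \<iota>"
  unfolding involute_def using involute_unique by blast

lemma is_involute_involute: "\<gamma> \<in> cycloidal \<Longrightarrow> is_involute \<gamma> (involute \<gamma>)"
proof -
  assume "\<gamma> \<in> cycloidal"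
  then obtain \<iota> where "is_involute \<gamma> \<iota>" by (rule involute_exists)
  with involute_eqI[OF this] show ?thesis by simp
qed

lemma involute_iterate_cycloidal: "\<gamma> \<in> cycloidal \<Longrightarrow> (involute ^^ n) \<gamma> \<in> cycloidal"
  by (induction n) (auto dest: is_involute_involute simp: is_involute_def)

section \<open>Convergence of the iterated involutes\<close>

lemma norm_le_inner_normal:
  "norm x \<le> \<bar>x \<bullet> normal t\<bar> + \<bar>x \<bullet> normal (t + pi / 2)\<bar>"
  by (subst normal_frame[of x t]) (rule norm_triangle_le, simp add: norm_normal)

lemma involute_iterates_converge:
  assumes "\<gamma> \<in> cycloidal"
  obtains v where "uniform_limit UNIV (\<lambda>n. translate (real n *\<^sub>R drift) ((involute ^^ n) \<gamma>))
    (translate v cycloid) sequentially"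
proof -
  \<comment> \<open>By \<open>has_integral_inner_normal_normal\<close>, this \<open>v\<close> is the
    vector whose \<open>v \<bullet> normal t\<close> is the first harmonic of the periodic part;
    subtracting it starts the induction for \<open>orth\<close>.\<close>
  define v where "v = (1 / pi) *\<^sub>R integral {0..2 * pi} (\<lambda>t. periodic_part \<gamma> t *\<^sub>R normal t)"
  \<comment> \<open>Both the accumulated drift and the first harmonic are removed, so the expected
    limit is \<open>cycloid\<close> itself.\<close>
  define \<delta> where "\<delta> n = translate (real n *\<^sub>R drift - v) ((involute ^^ n) \<gamma>)" for n
  define R where "R n = periodic_part (\<delta> n)" for n
  define \<kappa> where "\<kappa> = pi / 2 - 2 / pi"
  have \<delta>: "\<delta> n \<in> cycloidal" for n
    unfolding \<delta>_def by (intro translate_cycloidal involute_iterate_cycloidal assms)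
  then have ac: "angle_curve (\<delta> n)" and per: "R n (t + 2 * pi) = R n t"
    and mean: "integral {0..2 * pi} (R n) = 0" for n t
    by (auto simp: cycloidal_iff R_def)
  have cont: "continuous_on S (R n)" for n S
    unfolding R_def by (rule continuous_on_periodic_part[OF ac])
  \<comment> \<open>The evolute of \<open>\<delta> (Suc n)\<close> is \<open>\<delta> n\<close>
    translated by \<open>drift\<close>; this translation cancels the drift term of
    \<open>is_evolute_periodic_part\<close> and leaves a pure shift.\<close>
  have step: "(R (Suc n) has_real_derivative R n (t + pi / 2)) (at t)" for n t
  proof -
    let ?\<iota> = "(involute ^^ Suc n) \<gamma>"
    have "is_involute ((involute ^^ n) \<gamma>) ?\<iota>"
      using is_involute_involute[OF involute_iterate_cycloidal[OF assms, of n]] by simp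
    then have ev: "is_evolute ?\<iota> ((involute ^^ n) \<gamma>)" and "angle_curve ?\<iota>"
      by (auto simp: is_involute_def cycloidal_iff)
    then have "is_evolute (\<delta> (Suc n)) (translate drift (\<delta> n))"
      using angle_curve_translate[OF ac[of n], of drift]
      by (auto simp: is_evolute_iff_inner_normal \<delta>_def support_translate translate_def support_def
          algebra_simps)
    from is_evolute_periodic_part[OF ac this, of t] show ?thesis
      by (simp add: R_def periodic_part_translate)
  qed
  have orth: "integral {0..2 * pi} (\<lambda>t. R n t *\<^sub>R normal t) = 0" for n
  proof (induction n)
    case 0
    have ig: "(\<lambda>t. periodic_part \<gamma> t *\<^sub>R normal t) integrable_on {0..2 * pi}"
      using assms by (intro integrable_continuous_interval continuous_on_scaleR continuous_on_normal
          continuous_on_periodic_part) (simp add: cycloidal_iff)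
    have "R 0 t *\<^sub>R normal t = periodic_part \<gamma> t *\<^sub>R normal t - (v \<bullet> normal t) *\<^sub>R normal t" for t
      by (simp add: R_def \<delta>_def periodic_part_translate scaleR_diff_left)
    then show ?case
      using has_integral_diff[OF integrable_integral[OF ig] has_integral_inner_normal_normal[of v]]
      by (simp add: v_def integral_unique)
  next
    case (Suc n)
    then show ?case using first_harmonic_invariant[OF step cont per per] by simp
  qed
  obtain M where M: "\<And>t. \<bar>R 0 t\<bar> \<le> M"
    using periodic_bounded[OF cont per, of 0] by auto
  have bound: "\<bar>R n t\<bar> \<le> \<kappa> ^ n * M" for n t
  proof (induction n arbitrary: t)
    case 0
    show ?case using M by simp
  next
    case (Suc n)
    have "\<bar>R (Suc n) t\<bar> \<le> (pi / 2 - 2 / pi) * (\<kappa> ^ n * M)"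
      by (rule orthogonal_primitive_bound[OF step per mean orth Suc.IH])
    then show ?case by (simp add: \<kappa>_def)
  qed
  \<comment> \<open>The normal component of the difference is \<open>R (Suc n)\<close> and the
    tangential one is its derivative, a shift of \<open>R n\<close>. The derivative costs one index,
    hence \<open>Suc n\<close> on the left and the exponent \<open>n\<close> on the right.\<close>
  have close: "norm (\<delta> (Suc n) t - cycloid t) \<le> 2 * M * \<kappa> ^ n" for n t
  proof -
    let ?x = "\<delta> (Suc n) t - cycloid t"
    have "(periodic_part (\<delta> (Suc n)) has_real_derivative R n (t + pi / 2)) (at t)"
      using step[of n t] by (simp only: R_def)
    from DERIV_unique[OF angle_curve_periodic_part[OF ac] this]
    have "?x \<bullet> normal (t + pi / 2) = R n (t + pi / 2)" .
    moreover have "?x \<bullet> normal t = R (Suc n) t"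
      by (simp add: R_def periodic_part_def inner_diff_left flip: support_def) (simp add: support_cycloid)
    ultimately have "norm ?x \<le> \<bar>R (Suc n) t\<bar> + \<bar>R n (t + pi / 2)\<bar>"
      using norm_le_inner_normal[of ?x t] by simp
    also have "\<dots> \<le> \<kappa> ^ Suc n * M + \<kappa> ^ n * M"
      by (intro add_mono bound)
    also have "\<dots> \<le> \<kappa> ^ n * M + \<kappa> ^ n * M"
      using contraction_factor M[of 0] by (intro add_right_mono mult_right_mono power_decreasing)
        (auto simp: \<kappa>_def)
    finally show ?thesis by (simp add: algebra_simps)
  qed
  show ?thesis
  proof (rule that[of v], rule uniform_limitI)
    fix e :: real assume "0 < e"
    have "(\<lambda>n. 2 * M * \<kappa> ^ n) \<longlonglongrightarrow> 2 * M * 0"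
      using contraction_factor by (intro tendsto_mult_left LIMSEQ_power_zero) (simp add: \<kappa>_def)
    then have "\<forall>\<^sub>F n in sequentially. 2 * M * \<kappa> ^ n < e"
      using \<open>0 < e\<close> by (auto intro: order_tendstoD(2))
    then have "\<forall>\<^sub>F n in sequentially. \<forall>t\<in>UNIV. dist (translate (real (Suc n) *\<^sub>R drift)
        ((involute ^^ Suc n) \<gamma>) t) (translate v cycloid t) < e"
    proof eventually_elim
      case (elim n)
      have "dist (translate (real (Suc n) *\<^sub>R drift) ((involute ^^ Suc n) \<gamma>) t) (translate v cycloid t)
          = norm (\<delta> (Suc n) t - cycloid t)" for t
        unfolding dist_norm \<delta>_def translate_def by (simp only: algebra_simps)
      then show ?case using le_less_trans[OF close elim] by simp
    qed
    then show "\<forall>\<^sub>F n in sequentially. \<forall>t\<in>UNIV. dist (translate (real n *\<^sub>R drift)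
        ((involute ^^ n) \<gamma>) t) (translate v cycloid t) < e"
      by (rule eventually_sequentially_Suc[THEN iffD1])
  qed
qed

section \<open>Curves that are translates of their evolutes\<close>

lemma evolute_translate_imp_cycloid:
  assumes "\<gamma> \<in> cycloidal" "is_evolute \<gamma> (translate u \<gamma>)"
  obtains w where "\<gamma> = translate w cycloid"
proof -
  \<comment> \<open>Evolutes commute with translations: moving \<gamma> by \<open>x - u\<close>
    moves its evolute, the translate of \<gamma> by \<open>u\<close>, to the translate by
    \<open>x\<close>.\<close>
  have inv: "is_involute (translate x \<gamma>) (translate (x - u) \<gamma>)" for x
  proof -
    have "is_evolute (translate (x - u) \<gamma>) (translate x \<gamma>)"
      using assms angle_curve_translate[of \<gamma>]
      by (auto simp: is_evolute_iff_inner_normal support_translate translate_def support_def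
          cycloidal_iff inner_add_left inner_diff_left)
    then show ?thesis
      using translate_cycloidal[OF assms(1)] by (simp add: is_involute_def)
  qed
  have it: "(involute ^^ n) \<gamma> = translate (- real n *\<^sub>R u) \<gamma>" for n
  proof (induction n)
    case 0
    show ?case by (simp add: translate_def)
  next
    case (Suc n)
    then show ?case
      using involute_eqI[OF inv[of "- real n *\<^sub>R u"]] by (simp add: scaleR_left_diff_distrib minus_diff_commute)
  qed
  obtain v where "uniform_limit UNIV (\<lambda>n. translate (real n *\<^sub>R drift) ((involute ^^ n) \<gamma>))
      (translate v cycloid) sequentially"
    using involute_iterates_converge[OF assms(1)] .
  then have "(\<lambda>n. translate (real n *\<^sub>R drift) ((involute ^^ n) \<gamma>) t) \<longlonglongrightarrow> translate v cycloid t" for t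
    by (rule tendsto_uniform_limitI) simp
  then have lim: "(\<lambda>n. \<gamma> t + real n *\<^sub>R (drift - u)) \<longlonglongrightarrow> translate v cycloid t" for t
    by (simp add: it translate_def algebra_simps)
  \<comment> \<open>Consecutive differences of a convergent sequence tend to zero, but here they all
    equal \<open>drift - u\<close>.\<close>
  have "(\<lambda>n. (\<gamma> 0 + real (Suc n) *\<^sub>R (drift - u)) - (\<gamma> 0 + real n *\<^sub>R (drift - u))) \<longlonglongrightarrow>
      translate v cycloid 0 - translate v cycloid 0"
    by (intro tendsto_diff lim LIMSEQ_Suc[OF lim])
  then have "drift - u = 0"
    by (simp add: algebra_simps LIMSEQ_const_iff)
  \<comment> \<open>With \<open>u = drift\<close> the convergent sequence is constantly
    \<open>\<gamma> t\<close>.\<close>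
  then have "\<gamma> t = translate v cycloid t" for t
    using lim[of t] by (simp add: LIMSEQ_const_iff)
  then show ?thesis using that by blast
qed

theorem theorem3:
  shows "(\<forall>\<gamma> \<in> cycloidal. \<exists>!\<iota>. is_involute \<gamma> \<iota>) \<and>
    (\<forall>\<gamma> \<in> cycloidal. \<exists>v. uniform_limit UNIV
       (\<lambda>n. translate (real n *\<^sub>R drift) ((involute ^^ n) \<gamma>))
       (translate v cycloid) sequentially) \<and>
    (\<forall>\<gamma> \<in> cycloidal. (\<exists>v. is_evolute \<gamma> (translate v \<gamma>)) \<longrightarrow>
       (\<exists>w. \<gamma> = translate w cycloid))"
proof (intro conjI ballI impI)
  fix \<gamma> assume \<gamma>: "\<gamma> \<in> cycloidal"
  show "\<exists>!\<iota>. is_involute \<gamma> \<iota>"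
    using is_involute_involute[OF \<gamma>] involute_unique by blast
  show "\<exists>v. uniform_limit UNIV (\<lambda>n. translate (real n *\<^sub>R drift) ((involute ^^ n) \<gamma>))
      (translate v cycloid) sequentially"
    by (rule involute_iterates_converge[OF \<gamma>]) (rule exI)
  assume "\<exists>v. is_evolute \<gamma> (translate v \<gamma>)"
  then obtain v where "is_evolute \<gamma> (translate v \<gamma>)" ..
  then show "\<exists>w. \<gamma> = translate w cycloid"
    by (rule evolute_translate_imp_cycloid[OF \<gamma>]) (rule exI)
qed

end
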